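(* Let $G$ be a connected subcubic graph with infinite motion. Then $\chi_D(G)\leq 4$, where $\chi_D(G)$ is the distinguishing chromatic number of $G$.
   Context: Graphs are simple and undirected. A graph is subcubic if its maximum degree is at most $3$. The motion of an automorphism is the number of vertices moved by it, and the motion of a graph is the minimum of the motions of its non-identity automorphisms; thus a graph has infinite motion if every non-identity automorphism moves infinitely many vertices. The distinguishing chromatic number $\chi_D(G)$ is the minimum number of colours in a proper vertex colouring $c$ of $G$ (adjacent vertices receive distinct colours) that is preserved only by the trivial automorphism, where an automorphism $\varphi$ preserves $c$ if $c(\varphi(v))=c(v)$ for all vertices $v$. *)

theory Defs
  imports Main "HOL-Library.Extended_Nat"
begin

text \<open>
  A graph is given by a vertex set \<open>V\<close>, of arbitrary cardinality, and a set \<open>E\<close> of two-element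
  subsets of \<open>V\<close>. Only the finite cardinalities have to be told apart here, so cardinalities
  take values in \<^typ>\<open>enat\<close>; \<^const>\<open>card\<close> alone would send infinite sets to \<open>0\<close>.
\<close>

definition simple_graph :: "'a set \<Rightarrow> 'a set set \<Rightarrow> bool" where
  "simple_graph V E \<longleftrightarrow> (\<forall>e\<in>E. e \<subseteq> V \<and> card e = 2)"

definition connected_graph :: "'a set \<Rightarrow> 'a set set \<Rightarrow> bool" where
  "connected_graph V E \<longleftrightarrow> (\<forall>u\<in>V. \<forall>v\<in>V. (u, v) \<in> {(x, y). {x, y} \<in> E}\<^sup>*)"

definition ecard :: "'a set \<Rightarrow> enat" where
  "ecard A = (if finite A then enat (card A) else \<infinity>)"

definition degree :: "'a set \<Rightarrow> 'a set set \<Rightarrow> 'a \<Rightarrow> enat" where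
  "degree V E v = ecard {w \<in> V. {v, w} \<in> E}"

definition max_degree :: "'a set \<Rightarrow> 'a set set \<Rightarrow> enat" where
  "max_degree V E = (SUP v\<in>V. degree V E v)"

definition subcubic :: "'a set \<Rightarrow> 'a set set \<Rightarrow> bool" where
  "subcubic V E \<longleftrightarrow> max_degree V E \<le> 3"

text \<open>
  The values of an automorphism outside \<open>V\<close> are irrelevant; accordingly, the identity
  automorphism is represented by every function that fixes \<open>V\<close> pointwise.
\<close>

definition automorphism :: "'a set \<Rightarrow> 'a set set \<Rightarrow> ('a \<Rightarrow> 'a) \<Rightarrow> bool" where
  "automorphism V E \<phi> \<longleftrightarrow>
     bij_betw \<phi> V V \<and> (\<forall>u\<in>V. \<forall>v\<in>V. {\<phi> u, \<phi> v} \<in> E \<longleftrightarrow> {u, v} \<in> E)"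

definition trivial_on :: "'a set \<Rightarrow> ('a \<Rightarrow> 'a) \<Rightarrow> bool" where
  "trivial_on V \<phi> \<longleftrightarrow> (\<forall>v\<in>V. \<phi> v = v)"

definition automorphism_motion :: "'a set \<Rightarrow> ('a \<Rightarrow> 'a) \<Rightarrow> enat" where
  "automorphism_motion V \<phi> = ecard {v \<in> V. \<phi> v \<noteq> v}"

text \<open>
  In \<^typ>\<open>enat\<close> the infimum of a nonempty set is its minimum, and that of the empty set is \<open>\<infinity>\<close>;
  so a graph without nontrivial automorphisms has infinite motion.
\<close>

definition motion :: "'a set \<Rightarrow> 'a set set \<Rightarrow> enat" where
  "motion V E = Inf {automorphism_motion V \<phi> | \<phi>. automorphism V E \<phi> \<and> \<not> trivial_on V \<phi>}"

definition infinite_motion :: "'a set \<Rightarrow> 'a set set \<Rightarrow> bool" where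
  "infinite_motion V E \<longleftrightarrow> motion V E = \<infinity>"

lemma infinite_motion_iff:
  "infinite_motion V E \<longleftrightarrow>
     (\<forall>\<phi>. automorphism V E \<phi> \<and> \<not> trivial_on V \<phi> \<longrightarrow> infinite {v \<in> V. \<phi> v \<noteq> v})"
proof -
  have "infinite_motion V E \<longleftrightarrow>
     (\<forall>\<phi>. automorphism V E \<phi> \<and> \<not> trivial_on V \<phi> \<longrightarrow> automorphism_motion V \<phi> = \<infinity>)"
    by (auto simp: infinite_motion_def motion_def top_enat_def[symmetric])
  then show ?thesis
    unfolding automorphism_motion_def ecard_def by (metis enat.distinct(1))
qed

definition proper_colouring :: "'a set \<Rightarrow> 'a set set \<Rightarrow> ('a \<Rightarrow> 'c) \<Rightarrow> bool" where
  "proper_colouring V E c \<longleftrightarrow> (\<forall>u\<in>V. \<forall>v\<in>V. {u, v} \<in> E \<longrightarrow> c u \<noteq> c v)"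

definition preserves_colouring :: "'a set \<Rightarrow> ('a \<Rightarrow> 'c) \<Rightarrow> ('a \<Rightarrow> 'a) \<Rightarrow> bool" where
  "preserves_colouring V c \<phi> \<longleftrightarrow> (\<forall>v\<in>V. c (\<phi> v) = c v)"

definition distinguishing_colouring :: "'a set \<Rightarrow> 'a set set \<Rightarrow> ('a \<Rightarrow> 'c) \<Rightarrow> bool" where
  "distinguishing_colouring V E c \<longleftrightarrow>
     (\<forall>\<phi>. automorphism V E \<phi> \<and> preserves_colouring V c \<phi> \<longrightarrow> trivial_on V \<phi>)"

text \<open>
  The value is \<open>\<infinity>\<close> if finitely many colours do not suffice; when finitely many do, taking them
  to be natural numbers is no restriction.
\<close>

definition distinguishing_chromatic_number :: "'a set \<Rightarrow> 'a set set \<Rightarrow> enat" (\<open>\<chi>\<^sub>D\<close>) where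
  "\<chi>\<^sub>D V E = Inf {ecard (c ` V) | c :: 'a \<Rightarrow> nat.
     proper_colouring V E c \<and> distinguishing_colouring V E c}"

end

theory Submission
  imports Defs
begin

text \<open>
  Fix a root \<open>r\<close> and colour outwards from \<open>r\<close>, each time colouring all uncoloured neighbours of a
  coloured vertex \<open>p\<close>. If there are two of them, four colours suffice to give them different
  colours, unless they already differ in their coloured neighbours: the only obstruction would be
  two vertices with the same three neighbours, and swapping these has motion \<open>2\<close>. Hence a
  colour-preserving automorphism that fixes \<open>r\<close> is trivial.

  It remains to rule out, for each \<open>x \<noteq> r\<close> in turn, the automorphisms mapping \<open>r\<close> to \<open>x\<close>. If those
  still compatible with the finite coloured set \<open>F\<close> do not agree on a map from \<open>F\<close> to \<open>F\<close>, some
  \<open>y \<in> F\<close> is always mapped to an uncoloured neighbour of some \<open>p \<in> F\<close>. If they do agree, then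
  infinite motion yields a moved \<open>p \<in> F\<close> with uncoloured neighbours. In either case colouring the
  neighbours of \<open>p\<close> decreases the number of edges leaving \<open>F\<close>, or else these neighbours (in the
  second case together with those of the image of \<open>p\<close>) have so few coloured neighbours that they
  can be coloured incompatibly with all those automorphisms.
\<close>

locale subcubic_graph =
  fixes V :: "'a set" and E :: "'a set set" and r :: 'a
  assumes simple: "simple_graph V E"
    and connected: "connected_graph V E"
    and subcubic: "subcubic V E"
    and motion: "infinite_motion V E"
    and root: "r \<in> V"
begin

section \<open>Neighbourhoods and automorphisms\<close>

definition nbrs :: "'a \<Rightarrow> 'a set" where
  "nbrs v = {w. {v, w} \<in> E}"

lemma nbrs_sym: "u \<in> nbrs v \<longleftrightarrow> v \<in> nbrs u"
  by (simp add: nbrs_def insert_commute)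

lemma nbrs_irrefl [simp]: "v \<notin> nbrs v"
  using simple by (auto simp: nbrs_def simple_graph_def)

lemma nbrs_subset: "nbrs v \<subseteq> V"
  using simple by (auto simp: nbrs_def simple_graph_def)

lemma in_V_of_nbr: "u \<in> nbrs v \<Longrightarrow> v \<in> V"
  using nbrs_subset nbrs_sym by blast

lemma nbrs_degree: "finite (nbrs v) \<and> card (nbrs v) \<le> 3"
proof (cases "v \<in> V")
  case True
  then have "degree V E v \<le> 3"
    using subcubic unfolding subcubic_def max_degree_def by (meson SUP_upper order_trans)
  moreover have "{w \<in> V. {v, w} \<in> E} = nbrs v"
    using nbrs_subset by (auto simp: nbrs_def)
  ultimately have "ecard (nbrs v) \<le> enat 3"
    by (simp add: degree_def numeral_eq_enat)
  then show ?thesis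
    by (auto simp: ecard_def split: if_splits)
next
  case False
  then have "nbrs v = {}"
    using in_V_of_nbr by blast
  then show ?thesis by simp
qed

lemma finite_nbrs [simp]: "finite (nbrs v)"
  using nbrs_degree by blast

lemma card_nbrs: "card (nbrs v) \<le> 3"
  using nbrs_degree by blast

lemma automorphism_nbrs:
  assumes "automorphism V E \<phi>" "u \<in> V" "v \<in> V"
  shows "\<phi> u \<in> nbrs (\<phi> v) \<longleftrightarrow> u \<in> nbrs v"
  using assms by (auto simp: automorphism_def nbrs_def)

lemma automorphism_inj:
  assumes "automorphism V E \<phi>"
  shows "inj_on \<phi> V"
  using assms by (auto simp: automorphism_def bij_betw_def)

lemma automorphism_image_nbrs:
  assumes aut: "automorphism V E \<phi>" and v: "v \<in> V"
  shows "\<phi> ` nbrs v = nbrs (\<phi> v)"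
proof
  show "\<phi> ` nbrs v \<subseteq> nbrs (\<phi> v)"
    using automorphism_nbrs[OF aut _ v] nbrs_subset by blast
  show "nbrs (\<phi> v) \<subseteq> \<phi> ` nbrs v"
  proof
    fix w assume w: "w \<in> nbrs (\<phi> v)"
    then have "w \<in> V" using nbrs_subset by blast
    then obtain u where "u \<in> V" "w = \<phi> u"
      using aut unfolding automorphism_def bij_betw_def by blast
    then show "w \<in> \<phi> ` nbrs v"
      using automorphism_nbrs[OF aut _ v] w by blast
  qed
qed

lemma automorphism_in_V: "automorphism V E \<phi> \<Longrightarrow> v \<in> V \<Longrightarrow> \<phi> v \<in> V"
  by (auto simp: automorphism_def bij_betw_def)

text \<open>Infinite motion enters the argument in this form: automorphisms of finite support are
  built by hand in \<open>no_twins\<close> and \<open>moved_boundary_vertex\<close>, and this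
  collapses them to the identity.\<close>

lemma finite_motion_trivial:
  assumes "automorphism V E \<phi>" "finite F" "\<And>v. v \<in> V - F \<Longrightarrow> \<phi> v = v" "v \<in> V"
  shows "\<phi> v = v"
proof (rule ccontr)
  assume "\<phi> v \<noteq> v"
  then have "infinite {v \<in> V. \<phi> v \<noteq> v}"
    using assms(1,4) motion unfolding infinite_motion_iff trivial_on_def by blast
  moreover have "{v \<in> V. \<phi> v \<noteq> v} \<subseteq> F"
    using assms(3) by blast
  ultimately show False
    using assms(2) finite_subset by blast
qed

text \<open>Swapping the two vertices would be an automorphism of motion 2. The lemma is what keeps
  two uncoloured vertices from sharing all three neighbours.\<close>

lemma no_twins:
  assumes u: "u \<in> V" and v: "v \<in> V" and eq: "nbrs u = nbrs v"
  shows "u = v"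
proof (rule ccontr)
  assume ne: "u \<noteq> v"
  define \<phi> where "\<phi> = id(u := v, v := u)"
  have inv: "\<phi> (\<phi> x) = x" for x
    by (simp add: \<phi>_def)
  have inV: "\<phi> x \<in> V" if "x \<in> V" for x
    using that u v by (auto simp: \<phi>_def)
  have nb: "nbrs (\<phi> x) = nbrs x" for x
    using eq by (auto simp: \<phi>_def)
  have "bij_betw \<phi> V V"
    by (rule bij_betw_byWitness[where f' = \<phi>]) (use inv inV in auto)
  moreover have "{\<phi> x, \<phi> y} \<in> E \<longleftrightarrow> {x, y} \<in> E" for x y
  proof -
    \<comment> \<open>\<open>nb\<close> replaces one endpoint of the edge; by symmetry of adjacency
      it then replaces the other.\<close>
    have "\<phi> y \<in> nbrs (\<phi> x) \<longleftrightarrow> y \<in> nbrs x"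
      using nb nbrs_sym by metis
    then show ?thesis by (simp add: nbrs_def)
  qed
  ultimately have "automorphism V E \<phi>"
    by (simp add: automorphism_def)
  then have "\<phi> u = u"
    by (rule finite_motion_trivial[where F = "{u, v}"]) (use u in \<open>auto simp: \<phi>_def\<close>)
  then show False
    using ne by (simp add: \<phi>_def)
qed

section \<open>Good partial colourings\<close>

definition proper_on :: "'a set \<Rightarrow> ('a \<Rightarrow> nat) \<Rightarrow> bool" where
  "proper_on F c \<longleftrightarrow> (\<forall>v\<in>F. c v < 4) \<and> (\<forall>u\<in>F. \<forall>v\<in>F. u \<in> nbrs v \<longrightarrow> c u \<noteq> c v)"

text \<open>From any proper part \<open>T\<close> of \<open>F\<close> containing the root, one can move on to a vertex \<open>y\<close> that is
  told apart from all other candidates by its colour or by its neighbours in \<open>T\<close>. Quantifying over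
  \<open>T\<close> avoids recording the order in which \<open>F\<close> was coloured.\<close>

definition explored :: "'a set \<Rightarrow> ('a \<Rightarrow> nat) \<Rightarrow> bool" where
  "explored F c \<longleftrightarrow>
     (\<forall>T. T \<subseteq> F \<and> r \<in> T \<and> T \<noteq> F \<longrightarrow>
       (\<exists>p\<in>T. \<exists>y\<in>F - T. y \<in> nbrs p \<and>
         (\<forall>z\<in>nbrs p - T. z \<noteq> y \<longrightarrow> z \<in> F \<and> (c z \<noteq> c y \<or> nbrs z \<inter> T \<noteq> nbrs y \<inter> T))))"

text \<open>The bound 2 limits each step to two new vertices. A vertex reached from a coloured
  neighbour satisfies it automatically; the root satisfies it because the construction starts with
  all its neighbours coloured.\<close>

definition good :: "'a set \<Rightarrow> ('a \<Rightarrow> nat) \<Rightarrow> bool" where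
  "good F c \<longleftrightarrow> finite F \<and> F \<subseteq> V \<and> r \<in> F \<and> proper_on F c \<and>
     (\<forall>p\<in>F. card (nbrs p - F) \<le> 2) \<and> explored F c"

definition extends :: "'a set \<Rightarrow> ('a \<Rightarrow> nat) \<Rightarrow> 'a set \<Rightarrow> ('a \<Rightarrow> nat) \<Rightarrow> bool" where
  "extends F c F' c' \<longleftrightarrow> F \<subseteq> F' \<and> (\<forall>v\<in>F. c' v = c v)"

text \<open>A finite \<open>F\<close> need not be invariant, so colours are compared only where
  vertex and image both lie in \<open>F\<close>. Enlarging \<open>F\<close> adds constraints, which
  makes exclusion permanent.\<close>

definition compatible :: "'a set \<Rightarrow> ('a \<Rightarrow> nat) \<Rightarrow> ('a \<Rightarrow> 'a) \<Rightarrow> bool" where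
  "compatible F c \<phi> \<longleftrightarrow> (\<forall>v\<in>F. \<phi> v \<in> F \<longrightarrow> c (\<phi> v) = c v)"

definition excluded :: "'a \<Rightarrow> 'a set \<Rightarrow> ('a \<Rightarrow> nat) \<Rightarrow> bool" where
  "excluded x F c \<longleftrightarrow> (\<forall>\<phi>. automorphism V E \<phi> \<and> \<phi> r = x \<longrightarrow> \<not> compatible F c \<phi>)"

lemma extends_refl: "extends F c F c"
  by (simp add: extends_def)

lemma extends_trans: "extends F c F' c' \<Longrightarrow> extends F' c' F'' c'' \<Longrightarrow> extends F c F'' c''"
  unfolding extends_def by (metis subset_eq)

lemma compatible_mono: "extends F c F' c' \<Longrightarrow> compatible F' c' \<phi> \<Longrightarrow> compatible F c \<phi>"
  unfolding extends_def compatible_def by (metis subset_eq)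

lemma excluded_mono: "extends F c F' c' \<Longrightarrow> excluded x F c \<Longrightarrow> excluded x F' c'"
  unfolding excluded_def using compatible_mono by blast

text \<open>A test set \<open>T\<close> containing \<open>F\<close> misses a new neighbour of
  \<open>p\<close>, which \<open>sep\<close> tells apart. Otherwise \<open>T \<inter> F\<close> is a
  proper part of \<open>F\<close> and the old property applies to it. In both cases, neighbourhoods
  that differ within a smaller set still differ within \<open>T\<close>.\<close>

lemma explored_extend:
  assumes F: "explored F c" and p: "p \<in> F" and r: "r \<in> F" and ext: "\<forall>v\<in>F. c' v = c v"
    and sep: "\<And>u v. u \<in> nbrs p - F \<Longrightarrow> v \<in> nbrs p - F \<Longrightarrow> u \<noteq> v \<Longrightarrow>
                c' u \<noteq> c' v \<or> nbrs u \<inter> F \<noteq> nbrs v \<inter> F"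
  shows "explored (F \<union> nbrs p) c'"
  unfolding explored_def
proof (intro allI impI, elim conjE)
  fix T assume T: "T \<subseteq> F \<union> nbrs p" "r \<in> T" "T \<noteq> F \<union> nbrs p"
  show "\<exists>p'\<in>T. \<exists>y\<in>(F \<union> nbrs p) - T. y \<in> nbrs p' \<and> (\<forall>z\<in>nbrs p' - T. z \<noteq> y \<longrightarrow>
     z \<in> F \<union> nbrs p \<and> (c' z \<noteq> c' y \<or> nbrs z \<inter> T \<noteq> nbrs y \<inter> T))"
  proof (cases "F \<subseteq> T")
    case True
    then obtain y where y: "y \<in> nbrs p - T"
      using T by blast
    have "\<forall>z\<in>nbrs p - T. z \<noteq> y \<longrightarrow> c' z \<noteq> c' y \<or> nbrs z \<inter> T \<noteq> nbrs y \<inter> T"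
    proof (intro ballI impI)
      fix z assume "z \<in> nbrs p - T" "z \<noteq> y"
      then have "c' z \<noteq> c' y \<or> nbrs z \<inter> F \<noteq> nbrs y \<inter> F"
        using sep y True by blast
      then show "c' z \<noteq> c' y \<or> nbrs z \<inter> T \<noteq> nbrs y \<inter> T"
        using True by blast
    qed
    then show ?thesis
      using y p True by blast
  next
    case False
    then have "T \<inter> F \<subseteq> F" "r \<in> T \<inter> F" "T \<inter> F \<noteq> F"
      using T r by auto
    then obtain p' y where "p' \<in> T \<inter> F" and y: "y \<in> F - T \<inter> F" "y \<in> nbrs p'"
      and z: "\<forall>z\<in>nbrs p' - T \<inter> F. z \<noteq> y \<longrightarrow>
        z \<in> F \<and> (c z \<noteq> c y \<or> nbrs z \<inter> (T \<inter> F) \<noteq> nbrs y \<inter> (T \<inter> F))"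
      using F unfolding explored_def by meson
    have "\<forall>z\<in>nbrs p' - T. z \<noteq> y \<longrightarrow> z \<in> F \<and> (c' z \<noteq> c' y \<or> nbrs z \<inter> T \<noteq> nbrs y \<inter> T)"
    proof (intro ballI impI)
      fix z assume "z \<in> nbrs p' - T" "z \<noteq> y"
      then have "z \<in> F \<and> (c z \<noteq> c y \<or> nbrs z \<inter> (T \<inter> F) \<noteq> nbrs y \<inter> (T \<inter> F))"
        using z by blast
      then show "z \<in> F \<and> (c' z \<noteq> c' y \<or> nbrs z \<inter> T \<noteq> nbrs y \<inter> T)"
        using ext y(1) by (metis DiffD1 inf_assoc inf_commute)
    qed
    then show ?thesis
      using \<open>p' \<in> T \<inter> F\<close> y by blast
  qed
qed

text \<open>A new vertex has \<open>p\<close> among its at most three neighbours, so at most two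
  stay outside; an old vertex gains no outside neighbours.\<close>

lemma good_extend:
  assumes F: "good F c" and p: "p \<in> F" and ext: "\<forall>v\<in>F. c' v = c v"
    and proper: "proper_on (F \<union> nbrs p) c'"
    and sep: "\<And>u v. u \<in> nbrs p - F \<Longrightarrow> v \<in> nbrs p - F \<Longrightarrow> u \<noteq> v \<Longrightarrow>
                c' u \<noteq> c' v \<or> nbrs u \<inter> F \<noteq> nbrs v \<inter> F"
  shows "good (F \<union> nbrs p) c'"
proof -
  have "card (nbrs q - (F \<union> nbrs p)) \<le> 2" if q: "q \<in> F \<union> nbrs p" for q
  proof (cases "q \<in> F")
    case True
    have "card (nbrs q - (F \<union> nbrs p)) \<le> card (nbrs q - F)"
      by (rule card_mono) auto
    then show ?thesis
      using F True unfolding good_def by fastforce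
  next
    case False
    then have "p \<in> nbrs q"
      using q nbrs_sym by blast
    then have "nbrs q - (F \<union> nbrs p) \<subset> nbrs q"
      using p by blast
    then have "card (nbrs q - (F \<union> nbrs p)) < card (nbrs q)"
      by (simp add: psubset_card_mono)
    then show ?thesis
      using card_nbrs[of q] by linarith
  qed
  then show ?thesis
    using F proper explored_extend[OF _ p _ ext sep] nbrs_subset
    unfolding good_def by auto
qed

text \<open>Apply \<open>explored\<close> to the set \<open>T\<close> of fixed vertices of
  \<open>F\<close>. The vertex \<open>y\<close> it yields goes to another neighbour of
  \<open>p\<close> outside \<open>T\<close>; the image has the same neighbours in \<open>T\<close>,
  as these are fixed, and the same colour, so it cannot be told apart from \<open>y\<close>.\<close>

lemma good_rigid:
  assumes F: "good F c" and aut: "automorphism V E \<phi>" and "\<phi> r = r"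
    and comp: "compatible F c \<phi>" and v: "v \<in> F"
  shows "\<phi> v = v"
proof (rule ccontr)
  assume "\<phi> v \<noteq> v"
  define T where "T = {y \<in> F. \<phi> y = y}"
  have FV: "F \<subseteq> V" and rF: "r \<in> F"
    using F by (auto simp: good_def)
  have "T \<subseteq> F \<and> r \<in> T \<and> T \<noteq> F"
    using \<open>\<phi> v \<noteq> v\<close> v rF \<open>\<phi> r = r\<close> by (auto simp: T_def)
  then obtain p y where p: "p \<in> T" and y: "y \<in> F - T" "y \<in> nbrs p"
    and z: "\<forall>z\<in>nbrs p - T. z \<noteq> y \<longrightarrow> z \<in> F \<and> (c z \<noteq> c y \<or> nbrs z \<inter> T \<noteq> nbrs y \<inter> T)"
    using F unfolding good_def explored_def by meson
  have fix_T: "\<phi> q = q" if "q \<in> T" for q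
    using that by (simp add: T_def)
  have TV: "T \<subseteq> V" using FV by (auto simp: T_def)
  have yV: "y \<in> V" using y FV by blast
  have "\<phi> y \<in> nbrs p"
    using automorphism_nbrs[OF aut yV, of p] fix_T[OF p] p TV y(2) by auto
  moreover have ne: "\<phi> y \<noteq> y"
    using y(1) by (simp add: T_def)
  moreover have "\<phi> y \<notin> T"
  proof
    assume "\<phi> y \<in> T"
    then have "\<phi> (\<phi> y) = \<phi> y" "\<phi> y \<in> V" using fix_T TV by auto
    then have "\<phi> y = y"
      using automorphism_inj[OF aut] yV by (meson inj_onD)
    then show False using ne by blast
  qed
  ultimately have "\<phi> y \<in> F" and dist: "c (\<phi> y) \<noteq> c y \<or> nbrs (\<phi> y) \<inter> T \<noteq> nbrs y \<inter> T"
    using z by auto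
  then have "c (\<phi> y) = c y"
    using comp y(1) by (auto simp: compatible_def)
  moreover have "q \<in> nbrs (\<phi> y) \<longleftrightarrow> q \<in> nbrs y" if q: "q \<in> T" for q
    using automorphism_nbrs[OF aut _ yV, of q] fix_T[OF q] TV q by auto
  then have "nbrs (\<phi> y) \<inter> T = nbrs y \<inter> T"
    by blast
  ultimately show False
    using dist by blast
qed

section \<open>Choosing colours for the next vertices\<close>

lemma colour_avoiding:
  assumes "card A \<le> 3" "finite A"
  shows "\<exists>a::nat. a < 4 \<and> a \<notin> A"
proof (rule ccontr)
  assume "\<not> ?thesis"
  then have "{..<4} \<subseteq> A" by auto
  then have "card {..<4::nat} \<le> card A" using assms(2) card_mono by blast
  then show False using assms(1) by simp
qed

text \<open>By the bound on the sum, one forbidden set has at most two elements. Its colour is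
  chosen second, after the first colour has been added to that set.\<close>

lemma two_colours_avoiding:
  assumes "card A \<le> 3" "finite A" "card B \<le> 3" "finite B" "card A + card B \<le> 5"
  shows "\<exists>a b::nat. a < 4 \<and> b < 4 \<and> a \<notin> A \<and> b \<notin> B \<and> a \<noteq> b"
proof -
  have *: "\<exists>a b::nat. a < 4 \<and> b < 4 \<and> a \<notin> A \<and> b \<notin> B \<and> a \<noteq> b"
    if AB: "card A \<le> 3" "finite A" "card B \<le> 2" "finite B" for A B :: "nat set"
  proof -
    obtain a where a: "a < 4" "a \<notin> A" using colour_avoiding AB by blast
    have "card (insert a B) \<le> 3" using AB by (simp add: card_insert_if)
    then obtain b where "b < 4" "b \<notin> insert a B" using colour_avoiding AB by blast
    then show ?thesis using a by blast
  qed
  show ?thesis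
  proof (cases "card B \<le> 2")
    case True then show ?thesis using * assms by blast
  next
    case False
    then have "card A \<le> 2" using assms by linarith
    then show ?thesis using *[of B A] assms by blast
  qed
qed

lemma proper_on_insert:
  assumes "proper_on F c" "a < 4" "a \<notin> c ` (nbrs v \<inter> F)" "v \<notin> F"
  shows "proper_on (insert v F) (c(v := a))"
  using assms nbrs_sym unfolding proper_on_def by (auto simp: fun_upd_def)

text \<open>Each vertex forbids at most three colours through its neighbours. Nothing is said about
  telling the new vertices apart; that has to come from elsewhere.\<close>

lemma greedy:
  assumes "finite R" "proper_on F c"
  shows "\<exists>c'. proper_on (F \<union> R) c' \<and> (\<forall>v\<in>F. c' v = c v)"
  using assms(1)
proof induction
  case empty
  then show ?case using assms(2) by auto
next
  case (insert x R)
  then obtain c' where c': "proper_on (F \<union> R) c'" "\<forall>v\<in>F. c' v = c v" by blast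
  show ?case
  proof (cases "x \<in> F \<union> R")
    case True
    then have "F \<union> insert x R = F \<union> R" by blast
    then show ?thesis using c' by auto
  next
    case False
    have "card (c' ` (nbrs x \<inter> (F \<union> R))) \<le> card (nbrs x \<inter> (F \<union> R))"
      by (simp add: card_image_le)
    also have "\<dots> \<le> 3" using card_nbrs[of x] card_mono[of "nbrs x" "nbrs x \<inter> (F \<union> R)"] by auto
    finally obtain a where "a < 4" "a \<notin> c' ` (nbrs x \<inter> (F \<union> R))"
      using colour_avoiding by (metis finite_Int finite_imageI finite_nbrs)
    then have "proper_on (insert x (F \<union> R)) (c'(x := a))"
      using proper_on_insert c'(1) False by blast
    then show ?thesis using c'(2) False by (intro exI[of _ "c'(x := a)"]) (auto simp del: fun_upd_apply, auto)
  qed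
qed

lemma proper_on_insert2:
  assumes "proper_on F c" "u \<notin> F" "v \<notin> F" "u \<noteq> v" "a < 4" "b < 4" "a \<noteq> b"
    "a \<notin> c ` (nbrs u \<inter> F)" "b \<notin> c ` (nbrs v \<inter> F)"
  shows "proper_on (insert u (insert v F)) (c(v := b, u := a))"
proof (rule proper_on_insert)
  show "proper_on (insert v F) (c(v := b))"
    using assms by (intro proper_on_insert)
  show "a \<notin> c(v := b) ` (nbrs u \<inter> insert v F)"
    using assms by auto
qed (use assms in auto)

lemma outside_cases:
  assumes "good F c" "p \<in> F" "nbrs p - F \<noteq> {}"
  obtains u where "nbrs p - F = {u}" | u v where "nbrs p - F = {u, v}" "u \<noteq> v"
proof -
  have "card (nbrs p - F) \<le> 2" "card (nbrs p - F) \<noteq> 0"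
    using assms by (auto simp: good_def)
  then have "card (nbrs p - F) = 1 \<or> card (nbrs p - F) = 2" by linarith
  then show ?thesis
    using that by (metis card_1_singletonE card_2_iff)
qed

lemma outside_eq:
  assumes "good F c" "p \<in> F" and uv: "u \<in> nbrs p - F" "v \<in> nbrs p - F" "u \<noteq> v"
  shows "nbrs p - F = {u, v}"
proof -
  have "card (nbrs p - F) \<le> card {u, v}"
    using assms by (auto simp: good_def)
  then show ?thesis
    using card_seteq[of "nbrs p - F" "{u, v}"] uv by auto
qed

text \<open>Greedy colours suffice unless \<open>p\<close> has two uncoloured neighbours with the
  same coloured neighbours; only then must their colours be chosen different.\<close>

lemma extend_step:
  assumes F: "good F c" and p: "p \<in> F"
  shows "\<exists>c'. good (F \<union> nbrs p) c' \<and> extends F c (F \<union> nbrs p) c'"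
proof -
  have proper: "proper_on F c" using F by (simp add: good_def)
  obtain c1 where c1: "proper_on (F \<union> nbrs p) c1" "\<forall>v\<in>F. c1 v = c v"
    using greedy[OF finite_nbrs[of p] proper] by blast
  show ?thesis
  proof (cases "\<exists>u v. nbrs p - F = {u, v} \<and> u \<noteq> v \<and> nbrs u \<inter> F = nbrs v \<inter> F")
    case False
    have "good (F \<union> nbrs p) c1"
    proof (rule good_extend[OF F p c1(2,1)])
      fix u v assume uv: "u \<in> nbrs p - F" "v \<in> nbrs p - F" "u \<noteq> v"
      then have "nbrs p - F = {u, v}"
        using outside_eq[OF F p] by blast
      then show "c1 u \<noteq> c1 v \<or> nbrs u \<inter> F \<noteq> nbrs v \<inter> F"
        using False uv by blast
    qed
    then show ?thesis using c1 by (auto simp: extends_def)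
  next
    case True
    then obtain u v where uv: "nbrs p - F = {u, v}" "u \<noteq> v" "nbrs u \<inter> F = nbrs v \<inter> F" by blast
    \<comment> \<open>Three common coloured neighbours would be the whole neighbourhood of both
      vertices, making them twins.\<close>
    have le2: "card (nbrs u \<inter> F) \<le> 2"
    proof (rule ccontr)
      assume "\<not> ?thesis"
      then have "card (nbrs u) \<le> card (nbrs u \<inter> F)" "card (nbrs v) \<le> card (nbrs v \<inter> F)"
        using card_nbrs[of u] card_nbrs[of v] uv(3) by auto
      then have "nbrs u \<inter> F = nbrs u" "nbrs v \<inter> F = nbrs v"
        by (simp_all add: card_seteq)
      moreover have "u \<in> V" "v \<in> V" using uv nbrs_subset by blast+
      ultimately show False using no_twins[of u v] uv by metis
    qed
    then have "card (c ` (nbrs u \<inter> F)) \<le> 2" "card (c ` (nbrs v \<inter> F)) \<le> 2"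
      using card_image_le[of "nbrs u \<inter> F" c] uv(3) by auto
    then obtain a b where ab: "a < 4" "b < 4" "a \<notin> c ` (nbrs u \<inter> F)" "b \<notin> c ` (nbrs v \<inter> F)" "a \<noteq> b"
      using two_colours_avoiding[of "c ` (nbrs u \<inter> F)" "c ` (nbrs v \<inter> F)"] by auto
    let ?c = "c(v := b, u := a)"
    have notF: "u \<notin> F" "v \<notin> F" using uv by blast+
    have eq: "F \<union> nbrs p = insert u (insert v F)" using uv by blast
    have ext: "\<forall>v\<in>F. ?c v = c v" using notF by auto
    have "good (F \<union> nbrs p) ?c"
    proof (rule good_extend[OF F p ext])
      show "proper_on (F \<union> nbrs p) ?c"
        unfolding eq using proper_on_insert2[OF proper notF uv(2)] ab by blast
    qed (use uv ab in auto)
    then show ?thesis using ext by (auto simp: extends_def)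
  qed
qed

section \<open>The number of edges leaving the coloured set, as a measure of progress\<close>

definition boundary :: "'a set \<Rightarrow> nat" where
  "boundary F = (\<Sum>a\<in>F. card (nbrs a - F))"

text \<open>With k neighbours of \<open>w\<close> in \<open>F\<close>, adding \<open>w\<close>
  removes k leaving edges and creates at most 3 - k. The additive form avoids truncated
  subtraction.\<close>

lemma boundary_insert:
  assumes "finite F" "w \<notin> F"
  shows "boundary (insert w F) + 2 * card (nbrs w \<inter> F) \<le> boundary F + 3"
proof -
  have split: "card (nbrs a - F) = card (nbrs a - insert w F) + (if a \<in> nbrs w then 1 else 0)" for a
  proof (cases "a \<in> nbrs w")
    case True
    then have "nbrs a - F = insert w (nbrs a - insert w F)"
      using assms nbrs_sym[of w a] by blast
    then have "card (nbrs a - F) = Suc (card (nbrs a - insert w F))"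
      by (metis Diff_iff card_insert_disjoint finite_Diff finite_nbrs insertI1)
    then show ?thesis using True by simp
  next
    case False
    then have "nbrs a - F = nbrs a - insert w F"
      using False nbrs_sym[of w a] by blast
    then show ?thesis unfolding if_not_P[OF False] add_0_right by (rule arg_cong)
  qed
  have "boundary F = (\<Sum>a\<in>F. card (nbrs a - insert w F)) + (\<Sum>a\<in>F. if a \<in> nbrs w then 1 else 0)"
    unfolding boundary_def sum.distrib[symmetric] by (rule sum.cong[OF refl split])
  also have "(\<Sum>a\<in>F. if a \<in> nbrs w then 1 else 0) = card (nbrs w \<inter> F)"
    using assms(1) by (simp add: sum.If_cases[OF assms(1)] Int_commute)
  finally have 1: "boundary F = (\<Sum>a\<in>F. card (nbrs a - insert w F)) + card (nbrs w \<inter> F)" .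
  have 2: "boundary (insert w F) = card (nbrs w - insert w F) + (\<Sum>a\<in>F. card (nbrs a - insert w F))"
    unfolding boundary_def using assms by simp
  have "nbrs w - insert w F = nbrs w - F" by auto
  moreover have "card (nbrs w - F) + card (nbrs w \<inter> F) = card (nbrs w)"
    by (metis Int_Diff_Un Int_Diff_disjoint add.commute card_Un_disjoint finite_Diff finite_Int finite_nbrs)
  ultimately show ?thesis
    using 1 2 card_nbrs[of w] by simp
qed

lemma boundary_insert2:
  assumes "finite F" "u \<notin> F" "v \<notin> F" "u \<noteq> v"
  shows "boundary (insert u (insert v F)) + 2 * card (nbrs u \<inter> F) + 2 * card (nbrs v \<inter> F)
    \<le> boundary F + 6"
proof -
  have "boundary (insert u (insert v F)) + 2 * card (nbrs u \<inter> insert v F) \<le> boundary (insert v F) + 3"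
    using assms by (intro boundary_insert) auto
  moreover have "card (nbrs u \<inter> F) \<le> card (nbrs u \<inter> insert v F)"
    by (intro card_mono) auto
  ultimately show ?thesis
    using boundary_insert[of F v] assms by linarith
qed

section \<open>Excluding an image of the root through an uncoloured image\<close>

definition admissible :: "'a \<Rightarrow> 'a set \<Rightarrow> ('a \<Rightarrow> nat) \<Rightarrow> ('a \<Rightarrow> 'a) \<Rightarrow> bool" where
  "admissible x F c \<phi> \<longleftrightarrow> automorphism V E \<phi> \<and> \<phi> r = x \<and> compatible F c \<phi>"

lemma excluded_iff: "excluded x F c \<longleftrightarrow> (\<forall>\<phi>. \<not> admissible x F c \<phi>)"
  by (auto simp: excluded_def admissible_def)

lemma admissible_mono: "extends F c F' c' \<Longrightarrow> admissible x F' c' \<phi> \<Longrightarrow> admissible x F c \<phi>"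
  unfolding admissible_def using compatible_mono by blast

lemma admissible_colour: "admissible x F c \<phi> \<Longrightarrow> v \<in> F \<Longrightarrow> \<phi> v \<in> F \<Longrightarrow> c (\<phi> v) = c v"
  by (auto simp: admissible_def compatible_def)

lemma card_nbrs_in_pos:
  assumes "p \<in> F" "u \<in> nbrs p"
  shows "1 \<le> card (nbrs u \<inter> F)"
proof -
  have "p \<in> nbrs u \<inter> F" using assms nbrs_sym[of u p] by blast
  then have "card (nbrs u \<inter> F) \<noteq> 0" by auto
  then show ?thesis by linarith
qed

text \<open>Each new vertex has \<open>p\<close> as a coloured neighbour. Without a decrease,
  \<open>boundary_insert\<close> forces 2k \<le> 3 for a single new vertex with k coloured
  neighbours, and \<open>boundary_insert2\<close> forces k + l \<le> 3 for two. In the second case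
  \<open>u\<close> is chosen to have count 1.\<close>

lemma boundary_cases:
  assumes F: "good F c" and p: "p \<in> F" and ne: "nbrs p - F \<noteq> {}"
    and nodec: "\<not> boundary (F \<union> nbrs p) < boundary F"
  obtains (one) u where "nbrs p - F = {u}" "card (nbrs u \<inter> F) = 1"
  | (two) u v where "nbrs p - F = {u, v}" "u \<noteq> v" "card (nbrs u \<inter> F) = 1"
      "card (nbrs v \<inter> F) = 1 \<or> card (nbrs v \<inter> F) = 2"
proof -
  have fin: "finite F" using F by (simp add: good_def)
  show ?thesis
    using outside_cases[OF F p ne]
  proof cases
    case (1 u)
    then have "u \<notin> F" "u \<in> nbrs p" "F \<union> nbrs p = insert u F" by blast+
    then have "card (nbrs u \<inter> F) = 1"
      using nodec boundary_insert[OF fin, of u] card_nbrs_in_pos[OF p, of u] by simp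
    then show ?thesis using one 1 by blast
  next
    case (2 u v)
    then have uv: "u \<notin> F" "v \<notin> F" "u \<in> nbrs p" "v \<in> nbrs p" "F \<union> nbrs p = insert u (insert v F)"
      by blast+
    then have "card (nbrs u \<inter> F) + card (nbrs v \<inter> F) \<le> 3"
      using nodec boundary_insert2[OF fin uv(1,2) 2(2)] by simp
    moreover have "1 \<le> card (nbrs u \<inter> F)" "1 \<le> card (nbrs v \<inter> F)"
      using card_nbrs_in_pos[OF p] uv by blast+
    ultimately consider
        "card (nbrs u \<inter> F) = 1" "card (nbrs v \<inter> F) = 1 \<or> card (nbrs v \<inter> F) = 2"
      | "card (nbrs v \<inter> F) = 1" "card (nbrs u \<inter> F) = 1 \<or> card (nbrs u \<inter> F) = 2"
      by linarith
    then show ?thesis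
    proof cases
      case 1
      then show ?thesis using two[OF 2] by blast
    next
      case 2
      moreover have "nbrs p - F = {v, u}" "v \<noteq> u" using \<open>nbrs p - F = {u, v}\<close> \<open>u \<noteq> v\<close> by auto
      ultimately show ?thesis using two by blast
    qed
  qed
qed

lemma card_insert_colours:
  "card (insert k (c ` (nbrs u \<inter> F))) \<le> Suc (card (nbrs u \<inter> F))"
  using card_image_le[of "nbrs u \<inter> F" c] card_insert_le_m1[of "Suc (card (nbrs u \<inter> F))" "c ` (nbrs u \<inter> F)" k]
  by (simp add: card_insert_if)

text \<open>Every admissible automorphism sends \<open>y\<close> to a new vertex, so it suffices to
  keep the colour of \<open>y\<close> away from all new vertices. They also get pairwise different
  colours, which keeps the colouring good.\<close>

lemma exclude_by_new_image:
  assumes F: "good F c" and p: "p \<in> F" and y: "y \<in> F" and ne: "nbrs p - F \<noteq> {}"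
    and nodec: "\<not> boundary (F \<union> nbrs p) < boundary F"
    and img: "\<And>\<psi>. admissible x F c \<psi> \<Longrightarrow> \<psi> y \<in> nbrs p - F"
  shows "\<exists>F' c'. good F' c' \<and> extends F c F' c' \<and> excluded x F' c'"
proof -
  have proper: "proper_on F c" using F by (simp add: good_def)
  have conclude: ?thesis
    if c': "\<forall>v\<in>F. c' v = c v" "proper_on (F \<union> nbrs p) c'" "\<forall>w\<in>nbrs p - F. c' w \<noteq> c y"
      and inj: "\<And>u v. u \<in> nbrs p - F \<Longrightarrow> v \<in> nbrs p - F \<Longrightarrow> u \<noteq> v \<Longrightarrow> c' u \<noteq> c' v" for c'
  proof -
    have "good (F \<union> nbrs p) c'"
      using good_extend[OF F p c'(1,2)] inj by blast
    moreover have ext: "extends F c (F \<union> nbrs p) c'"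
      using c' by (auto simp: extends_def)
    moreover have "excluded x (F \<union> nbrs p) c'"
      unfolding excluded_iff
    proof (intro allI notI)
      fix \<psi> assume \<psi>: "admissible x (F \<union> nbrs p) c' \<psi>"
      then have im: "\<psi> y \<in> nbrs p - F" using img admissible_mono[OF ext] by blast
      then have "c' (\<psi> y) = c' y" using admissible_colour[OF \<psi>, of y] y by blast
      then show False using c' y im by metis
    qed
    ultimately show ?thesis by blast
  qed
  show ?thesis
    using F p ne nodec
  proof (cases rule: boundary_cases)
    case (one u)
    then have u: "u \<notin> F" "F \<union> nbrs p = insert u F" by blast+
    have "card (insert (c y) (c ` (nbrs u \<inter> F))) \<le> 3"
      using card_insert_colours[of "c y" c u F] one by simp
    then obtain a where a: "a < 4" "a \<notin> insert (c y) (c ` (nbrs u \<inter> F))"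
      using colour_avoiding by (metis finite_Int finite_imageI finite_insert finite_nbrs)
    show ?thesis
    proof (rule conclude)
      show "proper_on (F \<union> nbrs p) (c(u := a))"
        unfolding u(2) using a u by (intro proper_on_insert[OF proper]) auto
    qed (use one a u in auto)
  next
    case (two u v)
    then have uv: "u \<notin> F" "v \<notin> F" "F \<union> nbrs p = insert u (insert v F)" by blast+
    \<comment> \<open>With the colour of \<open>y\<close> added, the forbidden sets have at most 2
      and 3 elements, just within the bound 5.\<close>
    obtain a b where ab: "a < 4" "b < 4" "a \<notin> insert (c y) (c ` (nbrs u \<inter> F))"
        "b \<notin> insert (c y) (c ` (nbrs v \<inter> F))" "a \<noteq> b"
      using two_colours_avoiding[of "insert (c y) (c ` (nbrs u \<inter> F))" "insert (c y) (c ` (nbrs v \<inter> F))"]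
        card_insert_colours[of "c y" c u F] card_insert_colours[of "c y" c v F] two by auto
    show ?thesis
    proof (rule conclude)
      show "proper_on (F \<union> nbrs p) (c(v := b, u := a))"
        unfolding uv(3) using proper_on_insert2[OF proper uv(1,2) two(2)] ab by blast
    qed (use two ab uv in auto)
  qed
qed

section \<open>Excluding an image of the root when all images of coloured vertices are
  determined\<close>

lemma proper_on_subset: "proper_on F c \<Longrightarrow> F' \<subseteq> F \<Longrightarrow> proper_on F' c"
  unfolding proper_on_def by blast

text \<open>Two consecutive steps, at \<open>p\<close> and then at \<open>q\<close>; vertices that
  differ in their neighbours in \<open>F\<close> still differ in the larger set
  \<open>F \<union> nbrs p\<close>.\<close>

lemma good_extend2:
  assumes F: "good F c" and p: "p \<in> F" and q: "q \<in> F" and ext: "\<forall>v\<in>F. c' v = c v"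
    and proper: "proper_on (F \<union> nbrs p \<union> nbrs q) c'"
    and sep: "\<And>s u v. s = p \<or> s = q \<Longrightarrow> u \<in> nbrs s - F \<Longrightarrow> v \<in> nbrs s - F \<Longrightarrow> u \<noteq> v \<Longrightarrow>
                c' u \<noteq> c' v \<or> nbrs u \<inter> F \<noteq> nbrs v \<inter> F"
  shows "good (F \<union> nbrs p \<union> nbrs q) c'"
proof (rule good_extend)
  show "good (F \<union> nbrs p) c'"
    by (rule good_extend[OF F p ext proper_on_subset[OF proper]]) (use sep in auto)
  fix u v assume "u \<in> nbrs q - (F \<union> nbrs p)" "v \<in> nbrs q - (F \<union> nbrs p)" "u \<noteq> v"
  then have "c' u \<noteq> c' v \<or> nbrs u \<inter> F \<noteq> nbrs v \<inter> F"
    using sep[of q u v] by blast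
  then show "c' u \<noteq> c' v \<or> nbrs u \<inter> (F \<union> nbrs p) \<noteq> nbrs v \<inter> (F \<union> nbrs p)"
    by blast
qed (use q proper in auto)

text \<open>An injective map of the finite set \<open>F\<close> into itself is onto, so
  \<open>\<psi>\<close> permutes \<open>F\<close> and respects the split of each neighbourhood into
  coloured and uncoloured part.\<close>

lemma invariant_image:
  assumes aut: "automorphism V E \<psi>" and FV: "F \<subseteq> V" and fin: "finite F" and F: "\<psi> ` F \<subseteq> F"
    and v: "v \<in> V"
  shows "\<psi> ` (nbrs v - F) = nbrs (\<psi> v) - F" and "card (nbrs (\<psi> v) \<inter> F) = card (nbrs v \<inter> F)"
proof -
  have inj: "inj_on \<psi> V" using automorphism_inj[OF aut] .
  have "\<psi> ` F = F"
    by (rule endo_inj_surj[OF fin F inj_on_subset[OF inj FV]])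
  then show "\<psi> ` (nbrs v - F) = nbrs (\<psi> v) - F"
    using inj_on_image_set_diff[OF inj _ FV, of "nbrs v"] automorphism_image_nbrs[OF aut v] nbrs_subset[of v]
    by (metis Diff_subset order_trans)
  have "\<psi> ` (nbrs v \<inter> F) = nbrs (\<psi> v) \<inter> F"
    using inj_on_image_Int[OF inj nbrs_subset[of v] FV] automorphism_image_nbrs[OF aut v] \<open>\<psi> ` F = F\<close> by simp
  then show "card (nbrs (\<psi> v) \<inter> F) = card (nbrs v \<inter> F)"
    using card_image[of \<psi> "nbrs v \<inter> F"] inj_on_subset[OF inj, of "nbrs v \<inter> F"] FV by auto
qed

lemma three_colours:
  "\<exists>\<alpha> \<beta> \<gamma>::nat. \<alpha> < 4 \<and> \<beta> < 4 \<and> \<gamma> < 4 \<and> distinct [k, \<alpha>, \<beta>, \<gamma>]"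
proof -
  have "card {k} \<le> 3" by simp
  then obtain \<alpha> where \<alpha>: "\<alpha> < 4" "\<alpha> \<notin> {k}" using colour_avoiding by (metis finite.simps)
  have "card {k, \<alpha>} \<le> 3" using card_insert_le_m1[of 3 "{\<alpha>}" k] by (simp add: card_insert_if)
  then obtain \<beta> where \<beta>: "\<beta> < 4" "\<beta> \<notin> {k, \<alpha>}" using colour_avoiding by (metis finite.simps)
  have "card {k, \<alpha>, \<beta>} \<le> 3" by (simp add: card_insert_if)
  then obtain \<gamma> where "\<gamma> < 4" "\<gamma> \<notin> {k, \<alpha>, \<beta>}" using colour_avoiding by (metis finite.simps)
  then show ?thesis using \<alpha> \<beta> by (intro exI[of _ \<alpha>] exI[of _ \<beta>] exI[of _ \<gamma>]) auto
qed

text \<open>All admissible automorphisms send \<open>p\<close> to the same \<open>q\<close> and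
  preserve numbers of coloured neighbours. As \<open>u\<close> is the only new neighbour of
  \<open>p\<close> with count 1, they all send it to \<open>u' = \<phi> u\<close>; different colours
  on \<open>u\<close> and \<open>u'\<close> exclude them.\<close>

lemma exclude_by_unique_nbr:
  assumes F: "good F c" and p: "p \<in> F"
    and adm: "admissible x F c \<phi>"
    and agree: "\<And>\<psi> v. admissible x F c \<psi> \<Longrightarrow> v \<in> F \<Longrightarrow> \<psi> v = \<phi> v \<and> \<phi> v \<in> F"
    and moved: "\<phi> p \<noteq> p"
    and u: "u \<in> nbrs p - F" "card (nbrs u \<inter> F) = 1"
    and unique: "\<And>v. v \<in> nbrs p - F \<Longrightarrow> v \<noteq> u \<Longrightarrow> card (nbrs v \<inter> F) \<noteq> 1"
  shows "\<exists>F' c'. good F' c' \<and> extends F c F' c' \<and> excluded x F' c'"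
proof -
  have FV: "F \<subseteq> V" and fin: "finite F" and proper: "proper_on F c"
    using F by (auto simp: good_def)
  have aut: "automorphism V E \<psi>" if "admissible x F c \<psi>" for \<psi>
    using that by (simp add: admissible_def)
  have inv: "\<psi> ` F \<subseteq> F" if "admissible x F c \<psi>" for \<psi>
    using agree[OF that] by auto
  note image = invariant_image[OF aut FV fin inv]
  define q where "q = \<phi> p"
  have q: "q \<in> F" "q \<noteq> p" using agree[OF adm p] moved by (auto simp: q_def)
  have pV: "p \<in> V" using p FV by blast
  have outV: "v \<in> V" if "v \<in> nbrs p - F" for v using that nbrs_subset by blast
  have img: "\<psi> ` (nbrs p - F) = nbrs q - F" if "admissible x F c \<psi>" for \<psi>
    using image(1)[OF that that pV] agree[OF that p] by (simp add: q_def)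
  have crd: "card (nbrs (\<psi> v) \<inter> F) = card (nbrs v \<inter> F)"
    if "admissible x F c \<psi>" "v \<in> nbrs p - F" for \<psi> v
    using image(2)[OF that(1) that(1) outV[OF that(2)]] .
  define u' where "u' = \<phi> u"
  have u': "u' \<in> nbrs q - F" "card (nbrs u' \<inter> F) = 1"
    using img[OF adm] crd[OF adm u(1)] u by (auto simp: u'_def)
  have unique': "card (nbrs v \<inter> F) \<noteq> 1" if v: "v \<in> nbrs q - F" "v \<noteq> u'" for v
  proof -
    obtain w where w: "w \<in> nbrs p - F" "v = \<phi> w" using v(1) img[OF adm] by blast
    then have "w \<noteq> u" using v(2) by (auto simp: u'_def)
    then show ?thesis using unique[OF w(1)] crd[OF adm w(1)] w(2) by simp
  qed
  \<comment> \<open>If they coincided, this vertex would have two coloured neighbours,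
    \<open>p\<close> and \<open>q\<close>.\<close>
  have "u \<noteq> u'"
  proof
    assume eq: "u = u'"
    obtain w where w: "nbrs u \<inter> F = {w}"
      using u(2) card_1_singletonE by blast
    have "p \<in> nbrs u" "q \<in> nbrs u"
      using u(1) u'(1) nbrs_sym[of u p] nbrs_sym[of u' q] eq by auto
    then have "p = w" "q = w" using w p q(1) by blast+
    then show False using q(2) by blast
  qed
  have notF: "u \<notin> F" "u' \<notin> F" using u u' by blast+
  have "card (c ` (nbrs u \<inter> F)) \<le> 1" "card (c ` (nbrs u' \<inter> F)) \<le> 1"
    using card_image_le[of "nbrs u \<inter> F" c] card_image_le[of "nbrs u' \<inter> F" c] u(2) u'(2) by auto
  then obtain a b where ab: "a < 4" "b < 4" "a \<notin> c ` (nbrs u \<inter> F)" "b \<notin> c ` (nbrs u' \<inter> F)" "a \<noteq> b"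
    using two_colours_avoiding[of "c ` (nbrs u \<inter> F)" "c ` (nbrs u' \<inter> F)"] by auto
  let ?c = "c(u' := b, u := a)" and ?F = "F \<union> nbrs p \<union> nbrs q"
  have "proper_on (insert u (insert u' F)) ?c"
    using proper_on_insert2[OF proper notF \<open>u \<noteq> u'\<close>] ab by blast
  \<comment> \<open>The siblings of \<open>u\<close> and \<open>u'\<close> may be coloured greedily:
    they are told apart from \<open>u\<close> and \<open>u'\<close> by their number of coloured
    neighbours.\<close>
  then obtain c' where c': "proper_on (insert u (insert u' F) \<union> (nbrs p \<union> nbrs q)) c'"
      "\<forall>v\<in>insert u (insert u' F). c' v = ?c v"
    using greedy[of "nbrs p \<union> nbrs q" "insert u (insert u' F)" ?c] by auto
  have eqF: "insert u (insert u' F) \<union> (nbrs p \<union> nbrs q) = ?F"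
    using u(1) u'(1) by blast
  have ext: "\<forall>v\<in>F. c' v = c v" using c'(2) notF by auto
  have "good ?F c'"
  proof (rule good_extend2[OF F p q(1) ext])
    show "proper_on ?F c'" using c'(1) eqF by simp
    fix s v w assume s: "s = p \<or> s = q" "v \<in> nbrs s - F" "w \<in> nbrs s - F" "v \<noteq> w"
    then have vw: "nbrs s - F = {v, w}" and "s \<in> F" using outside_eq[OF F] p q by blast+
    define t where "t = (if s = p then u else u')"
    have t: "t \<in> nbrs s - F" "card (nbrs t \<inter> F) = 1"
      "\<And>z. z \<in> nbrs s - F \<Longrightarrow> z \<noteq> t \<Longrightarrow> card (nbrs z \<inter> F) \<noteq> 1"
      using s(1) u u' unique unique' q(2) by (auto simp: t_def)
    then have "card (nbrs v \<inter> F) \<noteq> card (nbrs w \<inter> F)"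
      using s vw by (metis insertE singletonD)
    then show "c' v \<noteq> c' w \<or> nbrs v \<inter> F \<noteq> nbrs w \<inter> F" by metis
  qed
  moreover have extends: "extends F c ?F c'" using ext by (auto simp: extends_def)
  moreover have "excluded x ?F c'"
    unfolding excluded_iff
  proof (intro allI notI)
    fix \<psi> assume \<psi>: "admissible x ?F c' \<psi>"
    then have \<psi>F: "admissible x F c \<psi>" using admissible_mono[OF extends] by blast
    have "\<psi> u \<in> nbrs q - F" using img[OF \<psi>F] u(1) by blast
    then have eq: "\<psi> u = u'" using unique' crd[OF \<psi>F u(1)] u(2) by metis
    then have "c' u' = c' u" using admissible_colour[OF \<psi>, of u] u(1) u'(1) by auto
    then show False using c'(2) ab(5) \<open>u \<noteq> u'\<close> by auto
  qed
  ultimately show ?thesis by blast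
qed

text \<open>Some \<open>a \<in> {u, v}\<close> and some neighbour \<open>b\<close> of the image of \<open>p\<close> are not adjacent, for otherwise \<open>u\<close>
  and \<open>v\<close> would be twins. Giving \<open>a\<close> and \<open>b\<close> the same colour leaves two different colours for their
  siblings.\<close>

lemma exclude_by_two_nbrs:
  assumes F: "good F c" and p: "p \<in> F"
    and adm: "admissible x F c \<phi>"
    and agree: "\<And>\<psi> v. admissible x F c \<psi> \<Longrightarrow> v \<in> F \<Longrightarrow> \<psi> v = \<phi> v \<and> \<phi> v \<in> F"
    and moved: "\<phi> p \<noteq> p"
    and uv: "nbrs p - F = {u, v}" "u \<noteq> v" "card (nbrs u \<inter> F) = 1" "card (nbrs v \<inter> F) = 1"
  shows "\<exists>F' c'. good F' c' \<and> extends F c F' c' \<and> excluded x F' c'"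
proof -
  have FV: "F \<subseteq> V" and fin: "finite F" and proper: "proper_on F c"
    using F by (auto simp: good_def)
  have aut: "automorphism V E \<psi>" if "admissible x F c \<psi>" for \<psi>
    using that by (simp add: admissible_def)
  have inv: "\<psi> ` F \<subseteq> F" if "admissible x F c \<psi>" for \<psi>
    using agree[OF that] by auto
  note image = invariant_image[OF aut FV fin inv]
  define q where "q = \<phi> p"
  have q: "q \<in> F" "q \<noteq> p" using agree[OF adm p] moved by (auto simp: q_def)
  have pV: "p \<in> V" using p FV by blast
  have uV: "u \<in> V" "v \<in> V" using uv nbrs_subset by blast+
  have img: "\<psi> ` (nbrs p - F) = nbrs q - F" if "admissible x F c \<psi>" for \<psi>
    using image(1)[OF that that pV] agree[OF that p] by (simp add: q_def)
  define u' v' where "u' = \<phi> u" and "v' = \<phi> v"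
  have out': "nbrs q - F = {u', v'}" using img[OF adm] uv(1) by (auto simp: u'_def v'_def)
  have "u' \<noteq> v'"
    using automorphism_inj[OF aut[OF adm]] uV uv(2) unfolding u'_def v'_def by (meson inj_onD)
  have cards: "card (nbrs u' \<inter> F) = 1" "card (nbrs v' \<inter> F) = 1"
    using image(2)[OF adm adm] uV uv unfolding u'_def v'_def by auto
  have single: "nbrs w \<inter> F = {s}" if "s \<in> F" "w \<in> nbrs s" "card (nbrs w \<inter> F) = 1" for s w
  proof -
    have "s \<in> nbrs w \<inter> F" using that nbrs_sym[of w s] by blast
    then show ?thesis using that(3) by (metis card_1_singletonE singletonD)
  qed
  have np: "nbrs w \<inter> F = {p}" if "w \<in> {u, v}" for w
  proof (rule single[OF p])
    show "w \<in> nbrs p" using that uv(1) by blast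
    show "card (nbrs w \<inter> F) = 1" using that uv by auto
  qed
  have nq: "nbrs w \<inter> F = {q}" if "w \<in> {u', v'}" for w
  proof (rule single[OF q(1)])
    show "w \<in> nbrs q" using that out' by blast
    show "card (nbrs w \<inter> F) = 1" using that cards by auto
  qed
  have disj: "w \<noteq> w'" if "w \<in> {u, v}" "w' \<in> {u', v'}" for w w'
    using np[OF that(1)] nq[OF that(2)] q(2) by auto
  have "\<exists>a\<in>{u, v}. \<exists>b\<in>{u', v'}. b \<notin> nbrs a"
  proof (rule ccontr)
    assume all: "\<not> ?thesis"
    have "nbrs w = {p, u', v'}" if w: "w \<in> {u, v}" for w
    proof -
      have "{p, u', v'} \<subseteq> nbrs w" using all np[OF w] w by blast
      moreover have "p \<noteq> u'" "p \<noteq> v'" using p out' by blast+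
      then have "card {p, u', v'} = 3" using \<open>u' \<noteq> v'\<close> by simp
      ultimately show ?thesis
        using card_nbrs[of w] card_seteq[of "nbrs w" "{p, u', v'}"] by simp
    qed
    then show False using no_twins[OF uV] uv(2) by blast
  qed
  then obtain a b where a0: "a \<in> {u, v}" and b0: "b \<in> {u', v'}" and nadj: "b \<notin> nbrs a" by blast
  obtain a' where a': "{u, v} = {a, a'}" "a \<noteq> a'" using a0 uv(2) by blast
  obtain b' where b': "{u', v'} = {b, b'}" "b \<noteq> b'" using b0 \<open>u' \<noteq> v'\<close> by blast
  have na: "nbrs a \<inter> F = {p}" "nbrs a' \<inter> F = {p}" using np a' by blast+
  have nb: "nbrs b \<inter> F = {q}" "nbrs b' \<inter> F = {q}" using nq b' by blast+
  have notF: "a \<notin> F" "a' \<notin> F" "b \<notin> F" "b' \<notin> F" using uv(1) out' a' b' by blast+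
  have mem: "a' \<in> {u, v}" "b' \<in> {u', v'}" unfolding a'(1) b'(1) by simp_all
  note ne = disj[OF a0 b0] disj[OF a0 mem(2)] disj[OF mem(1) b0] disj[OF mem]
  \<comment> \<open>Hence all four new vertices avoid the same single old colour, and three colours
    remain for them.\<close>
  have cq: "c q = c p" using admissible_colour[OF adm p] q(1) by (simp add: q_def)
  obtain \<alpha> \<beta> \<gamma> where col: "\<alpha> < 4" "\<beta> < 4" "\<gamma> < 4" "distinct [c p, \<alpha>, \<beta>, \<gamma>]"
    using three_colours by blast
  \<comment> \<open>The new neighbours of \<open>p\<close> receive \<alpha> and \<beta>, those of
    \<open>q\<close> receive \<alpha> and \<gamma>: two different sets of colours.\<close>
  let ?c = "c(a := \<alpha>, b := \<alpha>, a' := \<beta>, b' := \<gamma>)" and ?F = "F \<union> nbrs p \<union> nbrs q"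
  have eqF: "?F = insert b' (insert a' (insert b (insert a F)))"
    using uv(1) out' a' b' by blast
  have 1: "proper_on (insert a F) (c(a := \<alpha>))"
    using proper_on_insert[OF proper] col na notF by simp
  \<comment> \<open>Non-adjacency of \<open>a\<close> and \<open>b\<close> is what permits repeating
    \<alpha>.\<close>
  have "c(a := \<alpha>) ` (nbrs b \<inter> insert a F) \<subseteq> {c p}"
    using nb(1) nadj nbrs_sym[of a b] notF cq by auto
  then have "\<alpha> \<notin> c(a := \<alpha>) ` (nbrs b \<inter> insert a F)"
    using col(4) by auto
  then have 2: "proper_on (insert b (insert a F)) (c(a := \<alpha>, b := \<alpha>))"
    using proper_on_insert[OF 1 col(1), of b] notF ne by blast
  have "c(a := \<alpha>, b := \<alpha>) ` (nbrs a' \<inter> insert b (insert a F)) \<subseteq> {c p, \<alpha>}"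
    using na(2) by auto
  then have "\<beta> \<notin> c(a := \<alpha>, b := \<alpha>) ` (nbrs a' \<inter> insert b (insert a F))"
    using col(4) by auto
  then have 3: "proper_on (insert a' (insert b (insert a F))) (c(a := \<alpha>, b := \<alpha>, a' := \<beta>))"
    using proper_on_insert[OF 2 col(2), of a'] notF ne a'(2) by blast
  have "c(a := \<alpha>, b := \<alpha>, a' := \<beta>) ` (nbrs b' \<inter> insert a' (insert b (insert a F))) \<subseteq> {c p, \<alpha>, \<beta>}"
    using nb(2) cq by auto
  then have "\<gamma> \<notin> c(a := \<alpha>, b := \<alpha>, a' := \<beta>) ` (nbrs b' \<inter> insert a' (insert b (insert a F)))"
    using col(4) by auto
  then have 4: "proper_on ?F ?c"
    unfolding eqF using proper_on_insert[OF 3 col(3), of b'] notF ne b'(2) by blast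
  have ext: "\<forall>v\<in>F. ?c v = c v" using notF by auto
  have "good ?F ?c"
  proof (rule good_extend2[OF F p q(1) ext 4])
    fix s w w' assume s: "s = p \<or> s = q" "w \<in> nbrs s - F" "w' \<in> nbrs s - F" "w \<noteq> w'"
    from s(1) have "{w, w'} = {a, a'} \<or> {w, w'} = {b, b'}"
    proof
      assume "s = p" then show ?thesis using s(2-4) uv(1) a' by auto
    next
      assume "s = q" then show ?thesis using s(2-4) out' b' by auto
    qed
    then have "?c w \<noteq> ?c w'" using a'(2) b'(2) ne col(4) by (auto simp: doubleton_eq_iff)
    then show "?c w \<noteq> ?c w' \<or> nbrs w \<inter> F \<noteq> nbrs w' \<inter> F" ..
  qed
  moreover have extends: "extends F c ?F ?c" using ext by (auto simp: extends_def)
  moreover have "excluded x ?F ?c"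
    unfolding excluded_iff
  proof (intro allI notI)
    fix \<psi> assume \<psi>: "admissible x ?F ?c \<psi>"
    then have "admissible x F c \<psi>" using admissible_mono[OF extends] by blast
    then have "\<psi> ` {a, a'} = {b, b'}" using img uv(1) out' a' b' by metis
    \<comment> \<open>Neither possible image of \<open>a'\<close> has its colour \<beta>.\<close>
    then have im: "\<psi> a' = b \<or> \<psi> a' = b'" by blast
    moreover have "a' \<in> ?F" "b \<in> ?F" "b' \<in> ?F" unfolding eqF by auto
    ultimately have "?c (\<psi> a') = ?c a'" using admissible_colour[OF \<psi>, of a'] by metis
    then show False using im a'(2) b'(2) ne col(4) by auto
  qed
  ultimately show ?thesis by blast
qed

text \<open>If there were no such vertex, \<open>\<phi>\<close> on \<open>F\<close>, continued by the identity, would be an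
  automorphism of finite motion.\<close>

lemma moved_boundary_vertex:
  assumes FV: "F \<subseteq> V" and fin: "finite F" and aut: "automorphism V E \<phi>"
    and inv: "\<phi> ` F \<subseteq> F" and v: "v \<in> F" "\<phi> v \<noteq> v"
  shows "\<exists>p\<in>F. \<phi> p \<noteq> p \<and> nbrs p - F \<noteq> {}"
proof (rule ccontr)
  assume "\<not> ?thesis"
  then have stay: "nbrs p \<subseteq> F" if "p \<in> F" "\<phi> p \<noteq> p" for p
    using that by blast
  define \<psi> where "\<psi> = (\<lambda>v. if v \<in> F then \<phi> v else v)"
  have injF: "inj_on \<phi> F" using inj_on_subset[OF automorphism_inj[OF aut] FV] .
  have onto: "\<phi> ` F = F" by (rule endo_inj_surj[OF fin inv injF])
  have "bij_betw \<psi> F F"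
    using injF onto by (auto simp: bij_betw_def \<psi>_def inj_on_def image_def)
  moreover have "bij_betw \<psi> (V - F) (V - F)"
    by (auto simp: bij_betw_def \<psi>_def inj_on_def)
  ultimately have "bij_betw \<psi> (F \<union> (V - F)) (F \<union> (V - F))"
    by (rule bij_betw_combine) auto
  moreover have "F \<union> (V - F) = V" using FV by blast
  ultimately have bij: "bij_betw \<psi> V V" by simp
  have moved_image: "\<phi> (\<phi> a) \<noteq> \<phi> a" if "a \<in> F" "\<phi> a \<noteq> a" for a
  proof
    have "\<phi> a \<in> F" using that(1) inv by blast
    moreover assume "\<phi> (\<phi> a) = \<phi> a"
    ultimately show False using injF that by (meson inj_onD)
  qed
  \<comment> \<open>A moved \<open>a\<close> and its image, which is moved too, both have no
    neighbours outside \<open>F\<close>, so both sides are false.\<close>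
  have mixed: "b \<in> nbrs (\<phi> a) \<longleftrightarrow> b \<in> nbrs a" if "a \<in> F" "b \<notin> F" for a b
  proof (cases "\<phi> a = a")
    case False
    have "\<phi> a \<in> F" using that(1) inv by blast
    then show ?thesis using stay that False moved_image by blast
  qed simp
  have "\<psi> b \<in> nbrs (\<psi> a) \<longleftrightarrow> b \<in> nbrs a" if "a \<in> V" "b \<in> V" for a b
    using automorphism_nbrs[OF aut that(2,1)] mixed[of a b] mixed[of b a]
      nbrs_sym[of a b] nbrs_sym[of a "\<phi> b"] unfolding \<psi>_def by auto
  then have "automorphism V E \<psi>"
    using bij by (auto simp: automorphism_def nbrs_def)
  then have "\<psi> v = v"
    by (rule finite_motion_trivial[OF _ fin]) (use v FV in \<open>auto simp: \<psi>_def\<close>)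
  then show False using v by (simp add: \<psi>_def)
qed

section \<open>Combining the two kinds of exclusion\<close>

text \<open>Let \<open>T\<close> consist of the vertices of \<open>F\<close> with one common image,
  lying in \<open>F\<close>, under all admissible automorphisms. If \<open>T\<close> is not all of
  \<open>F\<close>, then \<open>explored\<close> supplies a vertex \<open>y\<close> outside
  \<open>T\<close>, and every image of \<open>y\<close> turns out to be uncoloured.\<close>

lemma admissible_cases:
  assumes F: "good F c" and x: "x \<in> F" and adm: "admissible x F c \<phi>"
  obtains (inside) "\<And>\<psi> v. admissible x F c \<psi> \<Longrightarrow> v \<in> F \<Longrightarrow> \<psi> v = \<phi> v \<and> \<phi> v \<in> F"
  | (outside) p y where "p \<in> F" "y \<in> F" "\<And>\<psi>. admissible x F c \<psi> \<Longrightarrow> \<psi> y \<in> nbrs p - F"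
proof -
  define T where "T = {y \<in> F. \<phi> y \<in> F \<and> (\<forall>\<psi>. admissible x F c \<psi> \<longrightarrow> \<psi> y = \<phi> y)}"
  have FV: "F \<subseteq> V" and rF: "r \<in> F" using F by (auto simp: good_def)
  have T: "\<psi> t = \<phi> t" "\<phi> t \<in> F" "t \<in> V" if "admissible x F c \<psi>" "t \<in> T" for \<psi> t
    using that FV by (auto simp: T_def)
  have aut: "automorphism V E \<psi>" if "admissible x F c \<psi>" for \<psi>
    using that by (simp add: admissible_def)
  show ?thesis
  proof (cases "T = F")
    case True
    then have "\<psi> v = \<phi> v \<and> \<phi> v \<in> F" if "admissible x F c \<psi>" "v \<in> F" for \<psi> v
      using that T by blast
    then show ?thesis using inside by blast
  next
    case False
    \<comment> \<open>All admissible automorphisms send \<open>r\<close> to \<open>x\<close>, which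
      lies in \<open>F\<close>.\<close>
    have "r \<in> T" using rF x adm by (auto simp: T_def admissible_def)
    moreover have "T \<subseteq> F" by (auto simp: T_def)
    ultimately obtain p y where p: "p \<in> T" and y: "y \<in> F - T" "y \<in> nbrs p"
      and z: "\<forall>z\<in>nbrs p - T. z \<noteq> y \<longrightarrow> z \<in> F \<and> (c z \<noteq> c y \<or> nbrs z \<inter> T \<noteq> nbrs y \<inter> T)"
      using F False unfolding good_def explored_def by meson
    have yV: "y \<in> V" using y(1) FV by blast
    have pV: "p \<in> V" using T(3)[OF adm p] .
    \<comment> \<open>One coloured image of \<open>y\<close> determines all images. If
      \<open>\<psi> y\<close> is coloured and differs from \<open>\<chi> y\<close>, its preimage
      \<open>z0\<close> under \<open>\<chi>\<close> is a neighbour of \<open>p\<close> outside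
      \<open>T\<close> with the colour of \<open>y\<close> and the same neighbours in
      \<open>T\<close>, contrary to the choice of \<open>y\<close>.\<close>
    have same: "\<chi> y = \<psi> y"
      if \<chi>: "admissible x F c \<chi>" and \<psi>: "admissible x F c \<psi>" and in_F: "\<psi> y \<in> F" for \<chi> \<psi>
    proof (rule ccontr)
      assume "\<chi> y \<noteq> \<psi> y"
      have "\<psi> y \<in> nbrs (\<psi> p)" using automorphism_nbrs[OF aut[OF \<psi>] yV pV] y(2) by blast
      then have "\<psi> y \<in> nbrs (\<chi> p)" using T(1)[OF \<chi> p] T(1)[OF \<psi> p] by simp
      then obtain z0 where z0: "z0 \<in> nbrs p" "\<psi> y = \<chi> z0"
        using automorphism_image_nbrs[OF aut[OF \<chi>] pV] by blast
      have "z0 \<noteq> y" using z0(2) \<open>\<chi> y \<noteq> \<psi> y\<close> by auto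
      moreover have "z0 \<notin> T"
      proof
        assume zT: "z0 \<in> T"
        then have "\<psi> z0 = \<psi> y" using T(1)[OF \<psi> zT] T(1)[OF \<chi> zT] z0(2) by simp
        then have "z0 = y"
          using automorphism_inj[OF aut[OF \<psi>]] T(3)[OF \<psi> zT] yV by (meson inj_onD)
        then show False using \<open>z0 \<noteq> y\<close> by blast
      qed
      ultimately have "z0 \<in> F" and dist: "c z0 \<noteq> c y \<or> nbrs z0 \<inter> T \<noteq> nbrs y \<inter> T"
        using z z0(1) by auto
      then have "c z0 = c y"
        using admissible_colour[OF \<chi>, of z0] admissible_colour[OF \<psi>, of y] z0(2) in_F y(1) by simp
      moreover have "t \<in> nbrs z0 \<longleftrightarrow> t \<in> nbrs y" if t: "t \<in> T" for t
      proof -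
        have "z0 \<in> V" using z0(1) nbrs_subset by blast
        have "t \<in> nbrs z0 \<longleftrightarrow> \<chi> t \<in> nbrs (\<chi> z0)"
          using automorphism_nbrs[OF aut[OF \<chi>] T(3)[OF \<chi> t] \<open>z0 \<in> V\<close>] by simp
        also have "\<dots> \<longleftrightarrow> \<psi> t \<in> nbrs (\<psi> y)"
          using T(1)[OF \<chi> t] T(1)[OF \<psi> t] z0(2) by simp
        also have "\<dots> \<longleftrightarrow> t \<in> nbrs y"
          using automorphism_nbrs[OF aut[OF \<psi>] T(3)[OF \<psi> t] yV] by simp
        finally show ?thesis .
      qed
      then have "nbrs z0 \<inter> T = nbrs y \<inter> T" by blast
      ultimately show False using dist by blast
    qed
    have "\<psi> y \<in> nbrs (\<phi> p) - F" if \<psi>: "admissible x F c \<psi>" for \<psi>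
    proof -
      have "\<psi> y \<in> nbrs (\<phi> p)"
        using automorphism_nbrs[OF aut[OF \<psi>] yV pV] y(2) T(1)[OF \<psi> p] by simp
      moreover have "\<psi> y \<notin> F"
      proof
        assume in_F: "\<psi> y \<in> F"
        have "\<chi> y = \<phi> y" if "admissible x F c \<chi>" for \<chi>
          using same[OF that \<psi> in_F] same[OF adm \<psi> in_F] by simp
        moreover have "\<phi> y \<in> F" using same[OF adm \<psi> in_F] in_F by simp
        ultimately have "y \<in> T" using y(1) by (auto simp: T_def)
        then show False using y(1) by blast
      qed
      ultimately show ?thesis by blast
    qed
    \<comment> \<open>The common image \<open>\<phi> p\<close> becomes the vertex \<open>p\<close>
      of the second alternative.\<close>
    moreover have "\<phi> p \<in> F" using T(2)[OF adm p] .
    ultimately show ?thesis using outside y(1) by blast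
  qed
qed

text \<open>Induction on the number of leaving edges: colouring the neighbours of a suitable
  \<open>p\<close> either lowers it, or the new vertices have few enough coloured neighbours for one
  of the exclusion lemmas.\<close>

lemma exclude_root_image:
  assumes "good F c" "x \<in> F" "x \<noteq> r"
  shows "\<exists>F' c'. good F' c' \<and> extends F c F' c' \<and> excluded x F' c'"
  using assms(1,2)
proof (induction "boundary F" arbitrary: F c rule: less_induct)
  case less
  note F = less.prems(1) and x = less.prems(2)
  have shrink: ?case if p: "p \<in> F" and dec: "boundary (F \<union> nbrs p) < boundary F" for p
  proof -
    obtain c1 where c1: "good (F \<union> nbrs p) c1" "extends F c (F \<union> nbrs p) c1"
      using extend_step[OF F p] by blast
    then obtain F' c' where "good F' c'" "extends (F \<union> nbrs p) c1 F' c'" "excluded x F' c'"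
      using less.hyps[OF dec c1(1)] x by blast
    then show ?thesis using extends_trans[OF c1(2)] by blast
  qed
  show ?case
  proof (cases "excluded x F c")
    case True
    then show ?thesis using F extends_refl by blast
  next
    case False
    then obtain \<phi> where adm: "admissible x F c \<phi>" by (auto simp: excluded_iff)
    show ?thesis
      using F x adm
    proof (cases rule: admissible_cases)
      case (outside p y)
      then have ne: "nbrs p - F \<noteq> {}" using adm by blast
      show ?thesis
      proof (cases "boundary (F \<union> nbrs p) < boundary F")
        case True
        then show ?thesis using shrink[OF outside(1)] by blast
      next
        case False
        show ?thesis
        proof (rule exclude_by_new_image[OF F outside(1,2) ne False])
          fix \<psi> assume "admissible x F c \<psi>"
          then show "\<psi> y \<in> nbrs p - F" by (rule outside(3))
        qed
      qed
    next
      case inside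
      have FV: "F \<subseteq> V" and fin: "finite F" and rF: "r \<in> F" using F by (auto simp: good_def)
      have ne: "\<phi> r \<noteq> r" and aut: "automorphism V E \<phi>" using adm assms(3) by (auto simp: admissible_def)
      have inv: "\<phi> ` F \<subseteq> F" using inside[OF adm] by blast
      \<comment> \<open>Here \<open>x \<noteq> r\<close> matters: the root itself is a moved vertex
        of \<open>F\<close>.\<close>
      obtain p where p: "p \<in> F" and moved: "\<phi> p \<noteq> p" and ne: "nbrs p - F \<noteq> {}"
        using moved_boundary_vertex[OF FV fin aut inv rF ne] by blast
      show ?thesis
      proof (cases "boundary (F \<union> nbrs p) < boundary F")
        case True
        then show ?thesis using shrink[OF p] by blast
      next
        case nodec: False
        show ?thesis
          using F p ne nodec
        proof (cases rule: boundary_cases)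
          case (one u)
          then have "u \<in> nbrs p - F" "\<And>v. v \<in> nbrs p - F \<Longrightarrow> v \<noteq> u \<Longrightarrow> card (nbrs v \<inter> F) \<noteq> 1"
            by blast+
          then show ?thesis
            using exclude_by_unique_nbr[OF F p adm _ moved, of u] inside one(2) by blast
        next
          case (two u v)
          show ?thesis
          proof (cases "card (nbrs v \<inter> F) = 1")
            case True
            show ?thesis
              using exclude_by_two_nbrs[OF F p adm _ moved two(1-3) True] inside by blast
          next
            case neq: False
            have "u \<in> nbrs p - F" "\<And>w. w \<in> nbrs p - F \<Longrightarrow> w \<noteq> u \<Longrightarrow> card (nbrs w \<inter> F) \<noteq> 1"
              using two(1) neq by blast+
            then show ?thesis
              using exclude_by_unique_nbr[OF F p adm _ moved, of u] inside two(3) by blast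
          qed
        qed
      qed
    qed
  qed
qed

section \<open>Construction of the limit colouring\<close>

lemma good_start: "\<exists>c. good (insert r (nbrs r)) c"
proof -
  obtain f :: "'a \<Rightarrow> nat" and n where f: "f ` nbrs r = {i. i < n}" "inj_on f (nbrs r)"
    using finite_imp_inj_to_nat_seg[OF finite_nbrs] by metis
  have n: "n \<le> 3"
    using card_image[OF f(2)] card_nbrs[of r] f(1) by simp
  \<comment> \<open>The neighbours of \<open>r\<close> carry distinct colours below 3, so 3 is free
    for \<open>r\<close>.\<close>
  define c where "c = f(r := 3)"
  have small: "c v < 3" "c v = f v" if "v \<in> nbrs r" for v
  proof -
    have "v \<noteq> r" using that by auto
    then show "c v = f v" by (simp add: c_def)
    have "f v \<in> f ` nbrs r" using that by blast
    then show "c v < 3" using f(1) n \<open>c v = f v\<close> by simp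
  qed
  have inj: "inj_on c (insert r (nbrs r))"
  proof (rule inj_onI)
    fix u v assume uv: "u \<in> insert r (nbrs r)" "v \<in> insert r (nbrs r)" "c u = c v"
    have "c r = 3" by (simp add: c_def)
    then show "u = v"
      using uv small f(2) by (metis inj_onD insertE less_irrefl)
  qed
  have lt: "c v < 4" if "v \<in> insert r (nbrs r)" for v
    using that small(1)[of v] by (auto simp: c_def)
  have "card (nbrs p - insert r (nbrs r)) \<le> 2" if p: "p \<in> insert r (nbrs r)" for p
  proof (cases "p = r")
    case True
    have "nbrs r - insert r (nbrs r) = {}" by blast
    then show ?thesis using True by simp
  next
    case False
    then have "r \<in> nbrs p" using p nbrs_sym[of p r] by blast
    then have "nbrs p - insert r (nbrs r) \<subset> nbrs p" by blast
    then have "card (nbrs p - insert r (nbrs r)) < card (nbrs p)" by (simp add: psubset_card_mono)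
    then show ?thesis using card_nbrs[of p] by linarith
  qed
  moreover have "proper_on (insert r (nbrs r)) c"
    unfolding proper_on_def using lt inj by (metis inj_onD nbrs_irrefl)
  moreover have "explored (insert r (nbrs r)) c"
    unfolding explored_def
  proof (intro allI impI, elim conjE)
    fix T assume T: "T \<subseteq> insert r (nbrs r)" "r \<in> T" "T \<noteq> insert r (nbrs r)"
    then obtain y where y: "y \<in> nbrs r - T" by blast
    have "z \<in> insert r (nbrs r) \<and> (c z \<noteq> c y \<or> nbrs z \<inter> T \<noteq> nbrs y \<inter> T)"
      if "z \<in> nbrs r - T" "z \<noteq> y" for z
      using that y inj by (auto dest: inj_onD)
    then show "\<exists>p\<in>T. \<exists>y\<in>insert r (nbrs r) - T. y \<in> nbrs p \<and> (\<forall>z\<in>nbrs p - T. z \<noteq> y \<longrightarrow>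
        z \<in> insert r (nbrs r) \<and> (c z \<noteq> c y \<or> nbrs z \<inter> T \<noteq> nbrs y \<inter> T))"
      using T(2) y by blast
  qed
  ultimately show ?thesis
    unfolding good_def using root nbrs_subset[of r] by auto
qed

lemma extend_over_nbrs:
  assumes F: "good F c" and S: "S \<subseteq> F"
  shows "\<exists>F' c'. good F' c' \<and> extends F c F' c' \<and> (\<Union>p\<in>S. nbrs p) \<subseteq> F'"
proof -
  have "finite S" using F S finite_subset by (auto simp: good_def)
  then show ?thesis using S
  proof induction
    case empty
    then show ?case using F extends_refl by blast
  next
    case (insert p S)
    then obtain F' c' where F': "good F' c'" "extends F c F' c'" "(\<Union>p\<in>S. nbrs p) \<subseteq> F'" by blast
    then have "p \<in> F'" using insert.prems by (auto simp: extends_def)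
    then obtain c'' where c'': "good (F' \<union> nbrs p) c''" "extends F' c' (F' \<union> nbrs p) c''"
      using extend_step F'(1) by blast
    moreover have "(\<Union>p\<in>insert p S. nbrs p) \<subseteq> F' \<union> nbrs p" using F'(3) by blast
    ultimately show ?case using extends_trans[OF F'(2)] by blast
  qed
qed

lemma exclude_root_images:
  assumes F: "good F c" and S: "S \<subseteq> F - {r}"
  shows "\<exists>F' c'. good F' c' \<and> extends F c F' c' \<and> (\<forall>x\<in>S. excluded x F' c')"
proof -
  have "finite S" using F S finite_subset by (auto simp: good_def)
  then show ?thesis using S
  proof induction
    case empty
    then show ?case using F extends_refl by blast
  next
    case (insert x S)
    then obtain F' c' where F': "good F' c'" "extends F c F' c'" "\<forall>x\<in>S. excluded x F' c'" by blast
    then have "x \<in> F'" "x \<noteq> r" using insert.prems by (auto simp: extends_def)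
    then obtain F'' c'' where "good F'' c''" "extends F' c' F'' c''" "excluded x F'' c''"
      using exclude_root_image F'(1) by blast
    then show ?case using F' extends_trans[OF F'(2)] excluded_mono by (metis insertE)
  qed
qed

text \<open>One round of the construction. Covering neighbours makes the stages exhaust
  \<open>V\<close>; excluding the old vertices as images of \<open>r\<close> makes the limit fix
  \<open>r\<close>.\<close>

lemma good_stage:
  assumes "good F c"
  shows "\<exists>F' c'. good F' c' \<and> extends F c F' c' \<and> (\<Union>p\<in>F. nbrs p) \<subseteq> F' \<and>
    (\<forall>x\<in>F - {r}. excluded x F' c')"
proof -
  obtain F1 c1 where 1: "good F1 c1" "extends F c F1 c1" "(\<Union>p\<in>F. nbrs p) \<subseteq> F1"
    using extend_over_nbrs[OF assms] by blast
  have sub: "F - {r} \<subseteq> F1 - {r}" using 1(2) by (auto simp: extends_def)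
  obtain F2 c2 where 2: "good F2 c2" "extends F1 c1 F2 c2" "\<forall>x\<in>F - {r}. excluded x F2 c2"
    using exclude_root_images[OF 1(1) sub] by blast
  moreover have "(\<Union>p\<in>F. nbrs p) \<subseteq> F2" using 1(3) 2(2) by (auto simp: extends_def)
  ultimately show ?thesis using extends_trans[OF 1(2)] by blast
qed

text \<open>A colour-preserving automorphism is compatible with every stage. If it moved
  \<open>r\<close>, the image would lie in some stage and be excluded at the next; so it fixes
  \<open>r\<close>, and \<open>good_rigid\<close> at each stage makes it trivial.\<close>

lemma limit_colouring:
  "\<exists>c :: 'a \<Rightarrow> nat. c ` V \<subseteq> {..<4} \<and> proper_colouring V E c \<and> distinguishing_colouring V E c"
proof -
  define P where "P = (\<lambda>n::nat. \<lambda>s::'a set \<times> ('a \<Rightarrow> nat). good (fst s) (snd s))"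
  define Q where "Q = (\<lambda>n::nat. \<lambda>s t::'a set \<times> ('a \<Rightarrow> nat). extends (fst s) (snd s) (fst t) (snd t) \<and>
    (\<Union>p\<in>fst s. nbrs p) \<subseteq> fst t \<and> (\<forall>x\<in>fst s - {r}. excluded x (fst t) (snd t)))"
  have "\<exists>s. P 0 s" using good_start by (auto simp: P_def)
  moreover have "\<exists>t. P (Suc n) t \<and> Q n s t" if "P n s" for n s
    using good_stage[of "fst s" "snd s"] that by (auto simp: P_def Q_def)
  ultimately obtain s where s: "\<And>n. P n (s n)" "\<And>n. Q n (s n) (s (Suc n))"
    using dependent_nat_choice[of P Q] by metis
  define F where "F n = fst (s n)" for n
  define C where "C n = snd (s n)" for n
  have good: "good (F n) (C n)" for n using s(1) by (simp add: P_def F_def C_def)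
  have stage: "extends (F n) (C n) (F (Suc n)) (C (Suc n))" "(\<Union>p\<in>F n. nbrs p) \<subseteq> F (Suc n)"
    "\<forall>x\<in>F n - {r}. excluded x (F (Suc n)) (C (Suc n))" for n
    using s(2)[of n] by (auto simp: Q_def F_def C_def)
  have ext: "extends (F m) (C m) (F n) (C n)" if "m \<le> n" for m n
    using that
  proof (induction n rule: dec_induct)
    case base
    show ?case by (rule extends_refl)
  next
    case (step k)
    then show ?case using extends_trans stage(1)[of k] by blast
  qed
  have cover: "\<exists>n. v \<in> F n" if v: "v \<in> V" for v
  proof -
    have "(r, v) \<in> {(x, y). {x, y} \<in> E}\<^sup>*"
      using connected root v by (auto simp: connected_graph_def)
    then show ?thesis
    proof induction
      case base
      show ?case using good[of 0] by (auto simp: good_def)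
    next
      case (step y z)
      then obtain n where "y \<in> F n" by blast
      moreover have "z \<in> nbrs y" using step by (simp add: nbrs_def)
      ultimately show ?case using stage(2)[of n] by blast
    qed
  qed
  \<comment> \<open>The first stage containing \<open>v\<close> is an arbitrary choice: later stages
    keep the colour.\<close>
  define c where "c v = C (LEAST n. v \<in> F n) v" for v
  have c: "c v = C n v" if v: "v \<in> F n" for v n
  proof -
    have "(LEAST n. v \<in> F n) \<le> n" "v \<in> F (LEAST n. v \<in> F n)"
      using v by (auto intro: Least_le LeastI)
    then show ?thesis using ext[of "LEAST n. v \<in> F n" n] by (simp add: c_def extends_def)
  qed
  have both: "\<exists>n. u \<in> F n \<and> v \<in> F n" if uv: "u \<in> V" "v \<in> V" for u v
  proof -
    obtain m n where "u \<in> F m" "v \<in> F n" using cover uv by meson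
    then have "u \<in> F (max m n)" "v \<in> F (max m n)"
      using ext[of m "max m n"] ext[of n "max m n"] by (auto simp: extends_def)
    then show ?thesis by blast
  qed
  have "c ` V \<subseteq> {..<4}"
  proof
    fix k assume "k \<in> c ` V"
    then obtain v where "v \<in> V" "k = c v" by blast
    moreover then obtain n where "v \<in> F n" using cover by blast
    ultimately show "k \<in> {..<4}" using good[of n] c by (auto simp: good_def proper_on_def)
  qed
  moreover have "proper_colouring V E c"
    unfolding proper_colouring_def
  proof (intro ballI impI)
    fix u v assume uv: "u \<in> V" "v \<in> V" "{u, v} \<in> E"
    obtain n where n: "u \<in> F n" "v \<in> F n" using both uv by blast
    have "v \<in> nbrs u" using uv(3) by (simp add: nbrs_def)
    then have "C n v \<noteq> C n u" using good[of n] n by (auto simp: good_def proper_on_def)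
    then show "c u \<noteq> c v" using c n by metis
  qed
  moreover have "distinguishing_colouring V E c"
    unfolding distinguishing_colouring_def
  proof (intro allI impI, elim conjE)
    fix \<phi> assume aut: "automorphism V E \<phi>" and pres: "preserves_colouring V c \<phi>"
    have comp: "compatible (F n) (C n) \<phi>" for n
      unfolding compatible_def
    proof (intro ballI impI)
      fix v assume v: "v \<in> F n" "\<phi> v \<in> F n"
      then have "v \<in> V" using good[of n] by (auto simp: good_def)
      then have "c (\<phi> v) = c v" using pres by (simp add: preserves_colouring_def)
      then show "C n (\<phi> v) = C n v" using c v by metis
    qed
    have "\<phi> r = r"
    proof (rule ccontr)
      assume ne: "\<phi> r \<noteq> r"
      obtain n where "\<phi> r \<in> F n" using cover automorphism_in_V[OF aut root] by blast
      then have "excluded (\<phi> r) (F (Suc n)) (C (Suc n))" using stage(3)[of n] ne by blast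
      then show False using aut comp by (auto simp: excluded_def)
    qed
    then show "trivial_on V \<phi>"
      unfolding trivial_on_def using cover good_rigid[OF good aut _ comp] by blast
  qed
  ultimately show ?thesis by blast
qed

end

theorem theorem11:
  fixes V :: "'a set" and E :: "'a set set"
  assumes "simple_graph V E"
    and "connected_graph V E"
    and "subcubic V E"
    and "infinite_motion V E"
  shows "\<chi>\<^sub>D V E \<le> 4"
proof -
  obtain c :: "'a \<Rightarrow> nat" where c: "c ` V \<subseteq> {..<4}" "proper_colouring V E c" "distinguishing_colouring V E c"
  \<comment> \<open>The locale needs a root, so the empty graph is treated apart.\<close>
  proof (cases "V = {}")
    case True
    then show ?thesis
      using that[of "\<lambda>_. 0"]
      by (auto simp: proper_colouring_def distinguishing_colouring_def trivial_on_def)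
  next
    case False
    then obtain r where "r \<in> V" by blast
    with assms interpret subcubic_graph V E r
      by (intro subcubic_graph.intro)
    show ?thesis using limit_colouring that by blast
  qed
  have fin: "finite (c ` V)" using c(1) finite_subset by blast
  have "card (c ` V) \<le> 4" using card_mono[OF _ c(1)] by simp
  then have "ecard (c ` V) \<le> 4"
    using fin by (simp add: ecard_def numeral_eq_enat)
  moreover have "\<chi>\<^sub>D V E \<le> ecard (c ` V)"
    unfolding distinguishing_chromatic_number_def by (rule Inf_lower) (use c in blast)
  ultimately show ?thesis by (rule order_trans[rotated])
qed

end
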